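(* Let $(M,c,D)$ be a non-closed conformal product, where $M:=U_1\times U_2$ with $U_1,U_2\subset\mathbb{R}^2$ open, $c:=[g_1+e^{2f}g_2]$ with $f:M\to\mathbb{R}$ a smooth function and $g_i$ the Euclidean metric on $U_i$, and $D$ is the adapted Weyl structure. Then $(M,c,D)$ is hyper-Hermitian if and only if $f$ is the real part of a holomorphic function in the complex variables $z:=x_1\pm ix_2\in U_1\subset\mathbb{R}^2$ and $w:=x_3\pm ix_4\in U_2$ (for some choice of the signs).
   Context: Here $x_1,x_2$ are the standard coordinates on $U_1\subset\mathbb{R}^2$ and $x_3,x_4$ those on $U_2\subset\mathbb{R}^2$; the two signs $\pm$ are chosen independently. A conformal structure is an equivalence class $[g]$ of Riemannian metrics modulo multiplication by positive functions. A Weyl structure is a torsion-free linear connection on $TM$ preserving the conformal structure; it is closed if it is locally the Levi-Civita connection of a metric in the conformal class, non-closed otherwise. The conformal structure $c=[g_1+e^{2f}g_2]$ on $U_1\times U_2$ is a conformal product of $(U_1,[g_1])$ and $(U_2,[g_2])$, meaning that both projections are conformal submersions with mutually orthogonal kernels; its adapted Weyl structure is the unique Weyl structure $D$ on $(M,c)$ for which both distributions $TU_1$ and $TU_2$ are $D$-parallel, and the conformal product is called non-closed if $D$ is non-closed. $(M,c,D)$ is hyper-Hermitian if there exist $D$-parallel $c$-orthogonal complex structures $I,J,K$ on $M$ satisfying the quaternionic relations $I^2=J^2=K^2=IJK=-\mathrm{Id}$.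
   Formalization: The equivalence is stated for simply connected U1, U2, since "only if" fails otherwise (f = log|z| + Re(zw) on (C∖{0})×C); for arbitrary open U1, U2, "if" is stated in full and "only if" on every V1×V2 with Vi ⊂ Ui open and simply connected. *)

theory Defs
  imports "HOL-Analysis.Analysis"
begin

text \<open>
  Differential geometry on an open subset \<open>M\<close> of a Euclidean space \<open>'a\<close>, where the tangent bundle
  is trivialised by the ambient coordinates: vector fields are functions \<open>'a \<Rightarrow> 'a\<close>, fields of
  endomorphisms are functions \<open>'a \<Rightarrow> 'a \<Rightarrow>\<^sub>L 'a\<close>, and only the values on \<open>M\<close> matter.
\<close>

primrec C_k_on :: "nat \<Rightarrow> 'a::euclidean_space set \<Rightarrow> ('a \<Rightarrow> 'b::real_normed_vector) \<Rightarrow> bool" where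
  "C_k_on 0 M F \<longleftrightarrow> continuous_on M F"
| "C_k_on (Suc k) M F \<longleftrightarrow>
     (\<forall>p\<in>M. F differentiable (at p)) \<and>
     (\<forall>v. C_k_on k M (\<lambda>p. frechet_derivative F (at p) v))"

definition smooth_on :: "'a::euclidean_space set \<Rightarrow> ('a \<Rightarrow> 'b::real_normed_vector) \<Rightarrow> bool" where
  "smooth_on M F \<longleftrightarrow> (\<forall>k. C_k_on k M F)"

type_synonym 'a metric = "'a \<Rightarrow> 'a \<Rightarrow> 'a \<Rightarrow> real"

definition riemannian_metric :: "'a::euclidean_space set \<Rightarrow> 'a metric \<Rightarrow> bool" where
  "riemannian_metric M g \<longleftrightarrow>
     (\<forall>u v. smooth_on M (\<lambda>p. g p u v)) \<and>
     (\<forall>p\<in>M. bilinear (g p) \<and> (\<forall>u v. g p u v = g p v u) \<and> (\<forall>u. u \<noteq> 0 \<longrightarrow> g p u u > 0))"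

definition conformal_class :: "'a::euclidean_space set \<Rightarrow> 'a metric \<Rightarrow> 'a metric set" where
  "conformal_class M g =
     {h. riemannian_metric M h \<and>
         (\<exists>\<phi>. smooth_on M \<phi> \<and> (\<forall>p\<in>M. \<phi> p > 0 \<and> (\<forall>u v. h p u v = \<phi> p * g p u v)))}"

text \<open>
  A linear connection on the trivialised bundle \<open>TM\<close> is the standard flat connection plus a
  smooth bilinear term \<open>\<Gamma>\<close> (the Christoffel symbols), and is represented by \<open>\<Gamma>\<close>; the covariant
  derivative of \<open>Y\<close> in the direction \<open>X\<close> is \<open>cov_deriv \<Gamma> X Y\<close>.
\<close>

type_synonym 'a connection = "'a \<Rightarrow> 'a \<Rightarrow> 'a \<Rightarrow> 'a"

definition linear_connection :: "'a::euclidean_space set \<Rightarrow> 'a connection \<Rightarrow> bool" where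
  "linear_connection M \<Gamma> \<longleftrightarrow>
     (\<forall>u v. smooth_on M (\<lambda>p. \<Gamma> p u v)) \<and> (\<forall>p\<in>M. bilinear (\<Gamma> p))"

definition cov_deriv ::
    "'a::euclidean_space connection \<Rightarrow> ('a \<Rightarrow> 'a) \<Rightarrow> ('a \<Rightarrow> 'a) \<Rightarrow> 'a \<Rightarrow> 'a" where
  "cov_deriv \<Gamma> X Y p = frechet_derivative Y (at p) (X p) + \<Gamma> p (X p) (Y p)"

definition lie_bracket :: "('a::euclidean_space \<Rightarrow> 'a) \<Rightarrow> ('a \<Rightarrow> 'a) \<Rightarrow> 'a \<Rightarrow> 'a" where
  "lie_bracket X Y p =
     frechet_derivative Y (at p) (X p) - frechet_derivative X (at p) (Y p)"

definition torsion_free :: "'a::euclidean_space set \<Rightarrow> 'a connection \<Rightarrow> bool" where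
  "torsion_free M D \<longleftrightarrow>
     (\<forall>X Y. smooth_on M X \<longrightarrow> smooth_on M Y \<longrightarrow>
        (\<forall>p\<in>M. cov_deriv D X Y p - cov_deriv D Y X p = lie_bracket X Y p))"

definition metric_deriv :: "'a::euclidean_space connection \<Rightarrow> 'a metric \<Rightarrow>
    ('a \<Rightarrow> 'a) \<Rightarrow> ('a \<Rightarrow> 'a) \<Rightarrow> ('a \<Rightarrow> 'a) \<Rightarrow> 'a \<Rightarrow> real" where
  "metric_deriv D g X Y Z p =
     frechet_derivative (\<lambda>q. g q (Y q) (Z q)) (at p) (X p)
       - g p (cov_deriv D X Y p) (Z p) - g p (Y p) (cov_deriv D X Z p)"

definition levi_civita :: "'a::euclidean_space set \<Rightarrow> 'a metric \<Rightarrow> 'a connection \<Rightarrow> bool" where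
  "levi_civita M g D \<longleftrightarrow>
     linear_connection M D \<and> torsion_free M D \<and>
     (\<forall>X Y Z. smooth_on M X \<longrightarrow> smooth_on M Y \<longrightarrow> smooth_on M Z \<longrightarrow>
        (\<forall>p\<in>M. metric_deriv D g X Y Z p = 0))"

text \<open>
  \<open>D\<close> preserves the conformal structure \<open>c\<close> iff \<open>D g = \<theta> \<otimes> g\<close> for a 1-form \<open>\<theta>\<close>, for every \<open>g \<in> c\<close>.
\<close>

definition preserves_conformal ::
    "'a::euclidean_space set \<Rightarrow> 'a metric set \<Rightarrow> 'a connection \<Rightarrow> bool" where
  "preserves_conformal M c D \<longleftrightarrow>
     (\<forall>g\<in>c. \<exists>\<theta>::'a \<Rightarrow> 'a \<Rightarrow> real. (\<forall>v. smooth_on M (\<lambda>p. \<theta> p v)) \<and> (\<forall>p\<in>M. linear (\<theta> p)) \<and>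
        (\<forall>X Y Z. smooth_on M X \<longrightarrow> smooth_on M Y \<longrightarrow> smooth_on M Z \<longrightarrow>
           (\<forall>p\<in>M. metric_deriv D g X Y Z p = \<theta> p (X p) * g p (Y p) (Z p))))"

definition weyl_structure ::
    "'a::euclidean_space set \<Rightarrow> 'a metric set \<Rightarrow> 'a connection \<Rightarrow> bool" where
  "weyl_structure M c D \<longleftrightarrow>
     linear_connection M D \<and> torsion_free M D \<and> preserves_conformal M c D"

definition closed_weyl ::
    "'a::euclidean_space set \<Rightarrow> 'a metric set \<Rightarrow> 'a connection \<Rightarrow> bool" where
  "closed_weyl M c D \<longleftrightarrow>
     (\<forall>p\<in>M. \<exists>V. open V \<and> p \<in> V \<and> V \<subseteq> M \<and>
        (\<exists>g\<in>c. \<exists>h\<in>conformal_class V g. levi_civita V h D))"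

definition parallel_distribution ::
    "'a::euclidean_space set \<Rightarrow> 'a connection \<Rightarrow> 'a set \<Rightarrow> bool" where
  "parallel_distribution M D T \<longleftrightarrow>
     (\<forall>X Y. smooth_on M X \<longrightarrow> smooth_on M Y \<longrightarrow> (\<forall>p\<in>M. Y p \<in> T) \<longrightarrow>
        (\<forall>p\<in>M. cov_deriv D X Y p \<in> T))"

text \<open>
  On a product, the distributions tangent to the two factors are
  \<open>UNIV \<times> {0}\<close> and \<open>{0} \<times> UNIV\<close> in every tangent space.
\<close>

definition adapted_weyl :: "('a::euclidean_space \<times> 'b::euclidean_space) set \<Rightarrow>
    ('a \<times> 'b) metric set \<Rightarrow> ('a \<times> 'b) connection \<Rightarrow> bool" where
  "adapted_weyl M c D \<longleftrightarrow>
     weyl_structure M c D \<and>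
     parallel_distribution M D (UNIV \<times> {0}) \<and> parallel_distribution M D ({0} \<times> UNIV)"

text \<open>Integrability of an almost complex structure is expressed by its Nijenhuis tensor.\<close>

definition nijenhuis ::
    "('a::euclidean_space \<Rightarrow> 'a \<Rightarrow>\<^sub>L 'a) \<Rightarrow> ('a \<Rightarrow> 'a) \<Rightarrow> ('a \<Rightarrow> 'a) \<Rightarrow> 'a \<Rightarrow> 'a" where
  "nijenhuis J X Y p =
     lie_bracket X Y p
       + J p (lie_bracket (\<lambda>q. J q (X q)) Y p) + J p (lie_bracket X (\<lambda>q. J q (Y q)) p)
       - lie_bracket (\<lambda>q. J q (X q)) (\<lambda>q. J q (Y q)) p"

definition complex_structure ::
    "'a::euclidean_space set \<Rightarrow> ('a \<Rightarrow> 'a \<Rightarrow>\<^sub>L 'a) \<Rightarrow> bool" where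
  "complex_structure M J \<longleftrightarrow>
     smooth_on M J \<and> (\<forall>p\<in>M. J p o\<^sub>L J p = - id_blinfun) \<and>
     (\<forall>X Y. smooth_on M X \<longrightarrow> smooth_on M Y \<longrightarrow> (\<forall>p\<in>M. nijenhuis J X Y p = 0))"

definition conformally_orthogonal ::
    "'a::euclidean_space set \<Rightarrow> 'a metric set \<Rightarrow> ('a \<Rightarrow> 'a \<Rightarrow>\<^sub>L 'a) \<Rightarrow> bool" where
  "conformally_orthogonal M c J \<longleftrightarrow>
     (\<forall>g\<in>c. \<forall>p\<in>M. \<forall>u v. g p (J p u) (J p v) = g p u v)"

definition parallel_endomorphism ::
    "'a::euclidean_space set \<Rightarrow> 'a connection \<Rightarrow> ('a \<Rightarrow> 'a \<Rightarrow>\<^sub>L 'a) \<Rightarrow> bool" where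
  "parallel_endomorphism M D J \<longleftrightarrow>
     (\<forall>X Y. smooth_on M X \<longrightarrow> smooth_on M Y \<longrightarrow>
        (\<forall>p\<in>M. cov_deriv D X (\<lambda>q. J q (Y q)) p = J p (cov_deriv D X Y p)))"

definition hyper_hermitian ::
    "'a::euclidean_space set \<Rightarrow> 'a metric set \<Rightarrow> 'a connection \<Rightarrow> bool" where
  "hyper_hermitian M c D \<longleftrightarrow>
     (\<exists>I J K.
        (\<forall>A\<in>{I, J, K}. complex_structure M A \<and> conformally_orthogonal M c A \<and>
                        parallel_endomorphism M D A) \<and>
        (\<forall>p\<in>M. I p o\<^sub>L J p o\<^sub>L K p = - id_blinfun))"

definition warped_metric :: "((real^2) \<times> (real^2) \<Rightarrow> real) \<Rightarrow> ((real^2) \<times> (real^2)) metric" where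
  "warped_metric f p u v = fst u \<bullet> fst v + exp (2 * f p) * (snd u \<bullet> snd v)"

text \<open>Holomorphy in two variables: existence of a complex-linear derivative at every point.\<close>

definition holomorphic2_on :: "(complex \<times> complex \<Rightarrow> complex) \<Rightarrow> (complex \<times> complex) set \<Rightarrow> bool" where
  "holomorphic2_on F S \<longleftrightarrow>
     (\<forall>p\<in>S. \<exists>a b. (F has_derivative (\<lambda>h. a * fst h + b * snd h)) (at p within S))"

text \<open>The complex coordinate \<open>x\<^sub>1 + s i x\<^sub>2\<close>, for a sign \<open>s \<in> {1, -1}\<close>.\<close>

definition complex_coord :: "real \<Rightarrow> real^2 \<Rightarrow> complex" where
  "complex_coord s x = Complex (x $ 1) (s * x $ 2)"

definition real_part_of_holomorphic ::
    "(real^2) set \<Rightarrow> (real^2) set \<Rightarrow> ((real^2) \<times> (real^2) \<Rightarrow> real) \<Rightarrow> bool" where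
  "real_part_of_holomorphic U1 U2 f \<longleftrightarrow>
     (\<exists>s\<in>{1, -1}. \<exists>t\<in>{1, -1}. \<exists>F.
        holomorphic2_on F ((complex_coord s ` U1) \<times> (complex_coord t ` U2)) \<and>
        (\<forall>x\<in>U1. \<forall>y\<in>U2. f (x, y) = Re (F (complex_coord s x, complex_coord t y))))"

end

theory Submission
  imports Defs
begin

text \<open>
  Torsion-freeness and compatibility with \<open>c\<close> force the adapted Weyl structure to be
  \<open>(- d\<^sub>1 f + \<omega>\<^sub>1 j) \<oplus> (d\<^sub>2 f + \<omega>\<^sub>2 j)\<close> on \<open>TU\<^sub>1 \<oplus> TU\<^sub>2\<close>, where \<open>j\<close> is the rotation by a right angle,
  \<open>\<omega>\<^sub>1 = f\<^sub>2 dx\<^sub>1 - f\<^sub>1 dx\<^sub>2\<close> and \<open>\<omega>\<^sub>2 = f\<^sub>3 dx\<^sub>4 - f\<^sub>4 dx\<^sub>3\<close>. A parallel orthogonal complex structure that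
  does not preserve the splitting restricts to a map \<open>e\<^sup>-\<^sup>f R: TU\<^sub>1 \<rightarrow> TU\<^sub>2\<close>, where up to a constant factor
  \<open>R = rotation(\<alpha>) \<circ> diag(1, \<delta>)\<close> with \<open>\<delta> = \<plusminus>1\<close>, and parallelism of it means exactly
  \<open>d\<alpha> = \<delta> \<omega>\<^sub>1 - \<omega>\<^sub>2\<close>. This equation is the system of Cauchy-Riemann equations for \<open>f - i \<delta> \<alpha>\<close> in
  the variables \<open>x\<^sub>1 + i x\<^sub>2\<close> and \<open>x\<^sub>3 + i \<delta> x\<^sub>4\<close>. On a simply connected domain the angle \<open>\<alpha>\<close> is obtained
  from \<open>R\<close> by lifting through the complex exponential. At least one of \<open>I\<close>, \<open>J\<close>, \<open>K\<close> does not preserve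
  the splitting at a given point, since otherwise they would all commute there.
\<close>

section \<open>Smooth functions\<close>

lemma C_k_on_cong:
  assumes "open M" "\<And>p. p \<in> M \<Longrightarrow> F p = G p"
  shows "C_k_on k M F \<longleftrightarrow> C_k_on k M G"
  using assms(2)
proof (induction k arbitrary: F G)
  case 0
  then show ?case by (simp cong: continuous_on_cong)
next
  case (Suc k)
  have hd: "(F has_derivative F') (at p) \<longleftrightarrow> (G has_derivative F') (at p)" if "p \<in> M" for p F'
    using Suc.prems that assms(1) has_derivative_transform_within_open[of _ F' p UNIV M]
    by (metis UNIV_I)
  have 1: "F differentiable (at p) \<longleftrightarrow> G differentiable (at p)" if "p \<in> M" for p
    using hd[OF that] by (simp add: differentiable_def)
  have 2: "frechet_derivative F (at p) = frechet_derivative G (at p)" if "p \<in> M" for p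
    using hd[OF that] by (simp add: frechet_derivative_def)
  have 3: "C_k_on k M (\<lambda>p. frechet_derivative F (at p) v)
       \<longleftrightarrow> C_k_on k M (\<lambda>p. frechet_derivative G (at p) v)" for v
    by (rule Suc.IH) (simp add: 2)
  show ?case using 1 3 by simp
qed

lemma C_k_on_Suc_imp: "C_k_on (Suc k) M F \<Longrightarrow> C_k_on k M F"
proof (induction k arbitrary: F)
  case 0
  then show ?case
    by (auto intro!: continuous_at_imp_continuous_on differentiable_imp_continuous_within)
next
  case (Suc k)
  then show ?case by (metis C_k_on.simps(2))
qed

text \<open>By \<open>C_k_on_cong\<close> a derivative known by a formula on \<open>M\<close> alone
  can stand for \<open>frechet_derivative\<close>. The inductions below feed their differentiation
  rules in here.\<close>

lemma C_k_on_SucI: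
  assumes "open M" "\<And>p. p \<in> M \<Longrightarrow> (F has_derivative F' p) (at p)"
    and "\<And>v. C_k_on k M (\<lambda>p. F' p v)"
  shows "C_k_on (Suc k) M F"
proof -
  have "C_k_on k M (\<lambda>p. frechet_derivative F (at p) v)" for v
  proof -
    have "F' p v = frechet_derivative F (at p) v" if "p \<in> M" for p
      using frechet_derivative_at[OF assms(2)[OF that]] by simp
    then show ?thesis
      using assms(3)[of v] C_k_on_cong[OF assms(1), of "\<lambda>p. F' p v"
          "\<lambda>p. frechet_derivative F (at p) v" k] by blast
  qed
  then show ?thesis using assms(2) by (auto simp: differentiable_def)
qed

lemma C_k_on_SucE:
  assumes "C_k_on (Suc k) M F"
  shows "p \<in> M \<Longrightarrow> (F has_derivative frechet_derivative F (at p)) (at p)"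
    and "C_k_on k M (\<lambda>p. frechet_derivative F (at p) v)"
  using assms by (auto simp: frechet_derivative_works)

lemma C_k_on_const: "open M \<Longrightarrow> C_k_on k M (\<lambda>p. a)"
proof (induction k arbitrary: a)
  case (Suc k)
  show ?case
    by (rule C_k_on_SucI[where F' = "\<lambda>p v. 0"]) (use Suc in \<open>simp_all del: C_k_on.simps\<close>)
qed simp

lemma C_k_on_add:
  assumes "open M"
  shows "C_k_on k M F \<Longrightarrow> C_k_on k M G \<Longrightarrow> C_k_on k M (\<lambda>p. F p + G p)"
proof (induction k arbitrary: F G)
  case 0
  then show ?case by (simp add: continuous_on_add)
next
  case (Suc k)
  then show ?case
    using C_k_on_SucE[OF Suc.prems(1)] C_k_on_SucE[OF Suc.prems(2)]
    by (intro C_k_on_SucI[OF assms has_derivative_add] Suc.IH) blast+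
qed

text \<open>The Leibniz rule yields two terms of the same bilinear shape, each with one factor
  undifferentiated, so the induction closes. One proof serves products, scalings, and application
  and composition of operators.\<close>

lemma (in bounded_bilinear) C_k_on:
  assumes "open M"
  shows "C_k_on k M F \<Longrightarrow> C_k_on k M G \<Longrightarrow> C_k_on k M (\<lambda>p. prod (F p) (G p))"
proof (induction k arbitrary: F G)
  case 0
  then show ?case unfolding C_k_on.simps by (rule continuous_on)
next
  case (Suc k)
  note F = C_k_on_SucE[OF Suc.prems(1)] and G = C_k_on_SucE[OF Suc.prems(2)]
  show ?case
  proof (rule C_k_on_SucI[OF assms])
    show "((\<lambda>p. prod (F p) (G p)) has_derivative
        (\<lambda>v. prod (F p) (frechet_derivative G (at p) v) + prod (frechet_derivative F (at p) v) (G p)))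
        (at p)" if "p \<in> M" for p
      using FDERIV[OF F(1)[OF that] G(1)[OF that]] .
    show "C_k_on k M (\<lambda>p. prod (F p) (frechet_derivative G (at p) v)
        + prod (frechet_derivative F (at p) v) (G p))" for v
      by (intro C_k_on_add assms Suc.IH F(2) G(2) C_k_on_Suc_imp[OF Suc.prems(1)]
          C_k_on_Suc_imp[OF Suc.prems(2)])
  qed
qed

text \<open>The outer function comes as the sequence of its successive derivatives, so that the
  chain rule moves from index \<open>n\<close> to \<open>Suc n\<close> and the induction hypothesis
  applies.\<close>

lemma C_k_on_compose_real:
  fixes F :: "'a::euclidean_space \<Rightarrow> real" and \<phi> :: "nat \<Rightarrow> real \<Rightarrow> real"
  assumes "open M" "\<And>n x. (\<phi> n has_real_derivative \<phi> (Suc n) x) (at x)"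
  shows "C_k_on k M F \<Longrightarrow> C_k_on k M (\<lambda>p. \<phi> n (F p))"
proof (induction k arbitrary: n)
  case 0
  have "continuous_on UNIV (\<phi> n)"
    using assms(2) by (meson DERIV_isCont continuous_at_imp_continuous_on)
  then show ?case using 0 by (auto intro: continuous_on_compose2)
next
  case (Suc k)
  have "((\<lambda>q. \<phi> n (F q)) has_derivative
      (\<lambda>v. frechet_derivative F (at p) v * \<phi> (Suc n) (F p))) (at p)" if "p \<in> M" for p
    using DERIV_compose_FDERIV[OF assms(2) C_k_on_SucE(1)[OF Suc.prems that]] .
  then show ?case
    by (rule C_k_on_SucI[OF assms(1)])
       (assumption, intro bounded_bilinear.C_k_on[OF bounded_bilinear_mult] assms(1)
         C_k_on_SucE(2)[OF Suc.prems] Suc.IH C_k_on_Suc_imp[OF Suc.prems])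
qed

section \<open>Closure properties of smooth functions\<close>

lemma smooth_on_const: "open M \<Longrightarrow> smooth_on M (\<lambda>p. a)"
  by (simp add: smooth_on_def C_k_on_const)

lemma smooth_on_add:
  "open M \<Longrightarrow> smooth_on M F \<Longrightarrow> smooth_on M G \<Longrightarrow> smooth_on M (\<lambda>p. F p + G p)"
  by (simp add: smooth_on_def C_k_on_add)

lemma smooth_on_bounded_bilinear:
  "bounded_bilinear B \<Longrightarrow> open M \<Longrightarrow> smooth_on M F \<Longrightarrow> smooth_on M G
    \<Longrightarrow> smooth_on M (\<lambda>p. B (F p) (G p))"
  by (simp add: smooth_on_def bounded_bilinear.C_k_on)

lemmas smooth_on_mult = smooth_on_bounded_bilinear[OF bounded_bilinear_mult]
  and smooth_on_scaleR = smooth_on_bounded_bilinear[OF bounded_bilinear_scaleR]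
  and smooth_on_blinfun_apply = smooth_on_bounded_bilinear[OF bounded_bilinear_blinfun_apply]
  and smooth_on_blinfun_compose = smooth_on_bounded_bilinear[OF bounded_bilinear_blinfun_compose]

lemma smooth_on_exp:
  fixes F :: "'a::euclidean_space \<Rightarrow> real"
  shows "open M \<Longrightarrow> smooth_on M F \<Longrightarrow> smooth_on M (\<lambda>p. exp (F p))"
  unfolding smooth_on_def using C_k_on_compose_real[of M "\<lambda>_. exp"] by (auto simp: DERIV_exp)

lemma smooth_on_cos:
  fixes F :: "'a::euclidean_space \<Rightarrow> real"
  assumes "open M" "smooth_on M F"
  shows "smooth_on M (\<lambda>p. cos (F p))"
proof -
  \<comment> \<open>The n-th derivative of cosine is cosine shifted by n quarter turns.\<close>
  have "((\<lambda>x. cos (x + real n * (pi/2))) has_real_derivative cos (x + real (Suc n) * (pi/2))) (at x)"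
    for n x
  proof -
    have "cos (x + real (Suc n) * (pi/2)) = - sin (x + real n * (pi/2))"
      using cos_add[of "x + real n * (pi/2)" "pi/2"] by (simp add: algebra_simps add_divide_distrib)
    then show ?thesis by (auto intro!: derivative_eq_intros)
  qed
  from C_k_on_compose_real[of M "\<lambda>n x. cos (x + real n * (pi/2))", OF assms(1) this, of _ F 0]
  show ?thesis using assms(2) by (simp add: smooth_on_def)
qed

lemma smooth_on_sin:
  fixes F :: "'a::euclidean_space \<Rightarrow> real"
  assumes "open M" "smooth_on M F"
  shows "smooth_on M (\<lambda>p. sin (F p))"
proof -
  have "smooth_on M (\<lambda>p. cos (F p + (- (pi/2))))"
    by (intro smooth_on_cos smooth_on_add smooth_on_const assms)
  then show ?thesis by (simp add: cos_diff)
qed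

lemma smooth_on_has_derivative:
  "smooth_on M F \<Longrightarrow> p \<in> M \<Longrightarrow> (F has_derivative frechet_derivative F (at p)) (at p)"
  using C_k_on_SucE(1) smooth_on_def by blast

lemma smooth_on_frechet_derivative:
  "smooth_on M F \<Longrightarrow> smooth_on M (\<lambda>p. frechet_derivative F (at p) v)"
  using C_k_on_SucE(2) smooth_on_def by blast

text \<open>Meant for the angle \<alpha>, which is known only through its differential.\<close>

lemma smooth_on_if_derivative_smooth_on:
  assumes "open M" "\<And>p. p \<in> M \<Longrightarrow> (F has_derivative F' p) (at p)"
    and "\<And>v. smooth_on M (\<lambda>p. F' p v)"
  shows "smooth_on M F"
proof -
  have "C_k_on (Suc k) M F" for k
    using assms C_k_on_SucI smooth_on_def by metis
  then show ?thesis using C_k_on_Suc_imp smooth_on_def by blast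
qed

section \<open>The adapted Weyl structure\<close>

text \<open>Together with the identity, \<open>rot\<close> spans the conformal Lie algebra of the
  plane, in which the blocks of the adapted connection take their values.\<close>

definition rot :: "real^2 \<Rightarrow> real^2" where
  "rot v = vector [- v $ 2, v $ 1]"

text \<open>Constant fields have zero derivative and zero bracket, so testing on them leaves only
  the Christoffel term. The next lemma uses the same test fields.\<close>

lemma torsion_free_symmetric:
  assumes "open M" "torsion_free M D" "p \<in> M"
  shows "D p u v = D p v u"
proof -
  have "cov_deriv D (\<lambda>_. u) (\<lambda>_. v) p - cov_deriv D (\<lambda>_. v) (\<lambda>_. u) p
      = lie_bracket (\<lambda>_. u) (\<lambda>_. v) p"
    using assms smooth_on_const unfolding torsion_free_def by blast
  then show ?thesis by (simp add: cov_deriv_def lie_bracket_def)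
qed

lemma parallel_distribution_const:
  assumes "open M" "parallel_distribution M D T" "p \<in> M" "v \<in> T"
  shows "D p u v \<in> T"
proof -
  have "cov_deriv D (\<lambda>_. u) (\<lambda>_. v) p \<in> T"
    using assms smooth_on_const unfolding parallel_distribution_def by blast
  then show ?thesis by (simp add: cov_deriv_def)
qed

lemma smooth_on_warped_metric:
  assumes "open M" "smooth_on M f"
  shows "smooth_on M (\<lambda>p. warped_metric f p u v)"
  unfolding warped_metric_def
  by (intro smooth_on_add smooth_on_const smooth_on_mult smooth_on_exp assms)

text \<open>Conditions quantified over all metrics of the class can thereby be evaluated at this
  representative.\<close>

lemma warped_metric_in_class:
  assumes "open M" "smooth_on M f"
  shows "warped_metric f \<in> conformal_class M (warped_metric f)"
proof -
  have "bilinear (warped_metric f p)" for p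
    unfolding warped_metric_def bilinear_def
    by (auto intro!: linearI simp: inner_add_left inner_add_right algebra_simps)
  moreover have "warped_metric f p u u > 0" if "u \<noteq> 0" for p u
    using that by (cases u) (auto simp: warped_metric_def zero_prod_def add_pos_nonneg add_nonneg_pos)
  ultimately have "riemannian_metric M (warped_metric f)"
    unfolding riemannian_metric_def
    using smooth_on_warped_metric[OF assms] by (auto simp: warped_metric_def inner_commute)
  then show ?thesis
    unfolding conformal_class_def
    by (auto intro!: exI[of _ "\<lambda>_. 1"] smooth_on_const assms)
qed

section \<open>The Christoffel symbols of the adapted connection\<close>

lemma koszul:
  fixes G :: "'a::real_inner \<Rightarrow> 'a \<Rightarrow> 'a"
  assumes "\<And>u v. G u v = G v u" "\<And>u v w. G u v \<bullet> w + v \<bullet> G u w = 2 * l u * (v \<bullet> w)"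
  shows "G u v \<bullet> w = l u * (v \<bullet> w) + l v * (u \<bullet> w) - l w * (u \<bullet> v)"
  \<comment> \<open>The first two instances minus the third: by symmetry of \<open>G\<close>
    everything but twice the wanted term cancels on the left.\<close>
  using assms(2)[of u v w] assms(2)[of v u w] assms(2)[of w u v] assms(1)[of u v] assms(1)[of u w]
    assms(1)[of v w]
  by (simp add: inner_commute)

text \<open>In the Koszul expression, l(v) (u . w) - l(w) (u . v) is skew in v and w. In the plane a
  skew map is a multiple of \<open>rot\<close>, and the coefficient is the one displayed.\<close>

lemma koszul_plane:
  fixes G :: "real^2 \<Rightarrow> real^2 \<Rightarrow> real^2"
  assumes "linear l" "\<And>u v. G u v = G v u"
    "\<And>u v w. G u v \<bullet> w + v \<bullet> G u w = 2 * l u * (v \<bullet> w)"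
  shows "G u v = l u *\<^sub>R v + (l (axis 1 1) * u $ 2 - l (axis 2 1) * u $ 1) *\<^sub>R rot v"
proof -
  have e: "u = u $ 1 *\<^sub>R axis 1 1 + u $ 2 *\<^sub>R axis 2 1" for u :: "real^2"
    by (simp add: vec_eq_iff forall_2 axis_def)
  have l: "l u = u $ 1 * l (axis 1 1) + u $ 2 * l (axis 2 1)" for u
    using arg_cong[OF e[of u], of l] assms(1) by (simp add: linear_add linear_scale)
  have "G u v \<bullet> axis i 1 = (l u *\<^sub>R v + (l (axis 1 1) * u $ 2 - l (axis 2 1) * u $ 1) *\<^sub>R rot v) \<bullet> axis i 1"
    for i
    unfolding koszul[OF assms(2,3)] l[of u] l[of v] using exhaust_2[of i]
    by (auto simp: rot_def inner_axis inner_vec_def[of u v] sum_2 algebra_simps)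
  then show ?thesis by (simp add: inner_axis vec_eq_iff)
qed

text \<open>The coefficient of \<open>rot\<close> in \<open>koszul_plane\<close> for l = -d_1 f; for
  \<open>omega2\<close> it is l = d_2 f. Up to sign these are the Hodge duals of the partial
  differentials of \<open>f\<close>.\<close>

definition omega1 :: "((real^2) \<times> (real^2) \<Rightarrow> real) \<Rightarrow> (real^2) \<times> (real^2) \<Rightarrow> real^2 \<Rightarrow> real" where
  "omega1 f p u = frechet_derivative f (at p) (axis 2 1, 0) * u $ 1
     - frechet_derivative f (at p) (axis 1 1, 0) * u $ 2"

definition omega2 :: "((real^2) \<times> (real^2) \<Rightarrow> real) \<Rightarrow> (real^2) \<times> (real^2) \<Rightarrow> real^2 \<Rightarrow> real" where
  "omega2 f p u = frechet_derivative f (at p) (0, axis 1 1) * u $ 2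
     - frechet_derivative f (at p) (0, axis 2 1) * u $ 1"

definition adapted_christoffel ::
    "((real^2) \<times> (real^2) \<Rightarrow> real) \<Rightarrow> ((real^2) \<times> (real^2)) connection" where
  "adapted_christoffel f p u v =
     (- frechet_derivative f (at p) (fst u, 0) *\<^sub>R fst v + omega1 f p (fst u) *\<^sub>R rot (fst v),
      frechet_derivative f (at p) (0, snd u) *\<^sub>R snd v + omega2 f p (snd u) *\<^sub>R rot (snd v))"

text \<open>Parallelism of both distributions and symmetry make \<open>D\<close> block diagonal
  without mixed terms. The 1-form \<theta> is then read off by testing on the opposite factor, and
  each block satisfies the hypotheses of \<open>koszul_plane\<close>.\<close>

lemma adapted_weyl_eq_christoffel:
  assumes M: "open M" and f: "smooth_on M f"
    and D: "adapted_weyl M (conformal_class M (warped_metric f)) D" and p: "p \<in> M"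
  shows "D p u v = adapted_christoffel f p u v"
proof -
  let ?g = "warped_metric f" and ?f' = "frechet_derivative f (at p)"
  have W: "weyl_structure M (conformal_class M ?g) D"
    and P1: "parallel_distribution M D (UNIV \<times> {0})" and P2: "parallel_distribution M D ({0} \<times> UNIV)"
    using D by (auto simp: adapted_weyl_def)
  have bil: "bilinear (D p)" and tf: "torsion_free M D"
    using W p by (auto simp: weyl_structure_def linear_connection_def)
  have fd: "(f has_derivative ?f') (at p)"
    by (rule smooth_on_has_derivative[OF f p])
  then have lin: "linear ?f'" by (rule has_derivative_linear)
  have sym: "D p u v = D p v u" for u v
    by (rule torsion_free_symmetric[OF M tf p])
  have snd0: "snd (D p u (v, 0)) = 0" for u v
    using parallel_distribution_const[OF M P1 p, of "(v, 0)" u] by (auto simp: mem_Times_iff)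
  have fst0: "fst (D p u (0, v)) = 0" for u v
    using parallel_distribution_const[OF M P2 p, of "(0, v)" u] by (auto simp: mem_Times_iff)
  \<comment> \<open>This vector is tangent to the second factor, and by symmetry also to the
    first.\<close>
  have mixed: "D p (u, 0) (0, v) = 0" for u v
    using fst0[of "(u, 0)" v] snd0[of "(0, v)" u] sym[of "(u, 0)" "(0, v)"] by (simp add: prod_eq_iff)
  obtain \<theta> where \<theta>: "\<And>X Y Z p. smooth_on M X \<Longrightarrow> smooth_on M Y \<Longrightarrow> smooth_on M Z \<Longrightarrow> p \<in> M \<Longrightarrow>
      metric_deriv D ?g X Y Z p = \<theta> p (X p) * ?g p (Y p) (Z p)"
    using W warped_metric_in_class[OF M f] unfolding weyl_structure_def preserves_conformal_def by blast
  have "((\<lambda>q. ?g q v w) has_derivative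
      (\<lambda>u. 2 * ?f' u * exp (2 * f p) * (snd v \<bullet> snd w))) (at p)" for v w
    unfolding warped_metric_def by (auto intro!: derivative_eq_intros fd)
  then have gd: "frechet_derivative (\<lambda>q. ?g q v w) (at p)
      = (\<lambda>u. 2 * ?f' u * exp (2 * f p) * (snd v \<bullet> snd w))" for v w
    by (rule frechet_derivative_at[symmetric])
  have compat: "2 * ?f' u * exp (2 * f p) * (snd v \<bullet> snd w) - ?g p (D p u v) w - ?g p v (D p u w)
      = \<theta> p u * ?g p v w" for u v w
    using \<theta>[of "\<lambda>_. u" "\<lambda>_. v" "\<lambda>_. w" p] M p
    by (simp add: smooth_on_const metric_deriv_def gd cov_deriv_def)
  \<comment> \<open>A vector of the second factor has no covariant derivative along the first, so
    only the derivative of the factor \<open>exp (2 * f p)\<close> contributes.\<close>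
  have "\<theta> p (u, 0) = 2 * ?f' (u, 0)" for u
    using compat[of "(u, 0)" "(0, axis 1 1)" "(0, axis 1 1)"]
    by (simp add: warped_metric_def mixed inner_axis)
  then have c1: "fst (D p (u, 0) (v, 0)) \<bullet> w + v \<bullet> fst (D p (u, 0) (w, 0))
      = 2 * (- ?f' (u, 0)) * (v \<bullet> w)" for u v w
    using compat[of "(u, 0)" "(v, 0)" "(w, 0)"] by (simp add: warped_metric_def)
  have "\<theta> p (0, u) = 0" for u
    using compat[of "(0, u)" "(axis 1 1, 0)" "(axis 1 1, 0)"] sym[of "(0, u)" "(axis 1 1, 0)"]
    by (simp add: warped_metric_def mixed inner_axis)
  then have "exp (2 * f p) * (snd (D p (0, u) (0, v)) \<bullet> w + v \<bullet> snd (D p (0, u) (0, w)))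
      = exp (2 * f p) * (2 * ?f' (0, u) * (v \<bullet> w))" for u v w
    using compat[of "(0, u)" "(0, v)" "(0, w)"] by (simp add: warped_metric_def algebra_simps)
  then have c2: "snd (D p (0, u) (0, v)) \<bullet> w + v \<bullet> snd (D p (0, u) (0, w))
      = 2 * ?f' (0, u) * (v \<bullet> w)" for u v w
    by (metis exp_not_eq_zero mult_cancel_left)
  have "linear (\<lambda>u::real^2. (u, 0::real^2))" "linear (\<lambda>u::real^2. (0::real^2, u))"
    by (auto intro!: linearI)
  from this[THEN linear_compose[OF _ lin]]
  have "linear (\<lambda>u. - ?f' (u, 0))" "linear (\<lambda>u. ?f' (0, u))"
    by (simp_all add: o_def linear_compose_neg)
  note koszul_plane[OF this(1) _ c1] and koszul_plane[OF this(2) _ c2]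
  then have k1: "fst (D p (u, 0) (v, 0)) = - ?f' (u, 0) *\<^sub>R v + omega1 f p u *\<^sub>R rot v"
    and k2: "snd (D p (0, u) (0, v)) = ?f' (0, u) *\<^sub>R v + omega2 f p u *\<^sub>R rot v" for u v
    using sym by (simp_all add: omega1_def omega2_def)
  have add: "D p (u + u') (v + v') = D p u v + D p u v' + D p u' v + D p u' v'" for u u' v v'
    by (simp add: bilinear_ladd[OF bil] bilinear_radd[OF bil])
  have "D p u v = D p ((fst u, 0) + (0, snd u)) ((fst v, 0) + (0, snd v))"
    by simp
  also have "\<dots> = D p (fst u, 0) (fst v, 0) + D p (0, snd u) (0, snd v)"
    unfolding add using sym[of "(0, snd u)" "(fst v, 0)"] by (simp add: mixed)
  finally show ?thesis
    by (simp add: prod_eq_iff adapted_christoffel_def k1 k2 snd0 fst0)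
qed

section \<open>Parallel endomorphisms and their integrability\<close>

lemma parallel_endomorphism_iff:
  assumes M: "open M" and J: "smooth_on M J"
  shows "parallel_endomorphism M D J \<longleftrightarrow>
    (\<forall>p\<in>M. \<forall>u v. frechet_derivative J (at p) u v + D p u (J p v) = J p (D p u v))"
proof -
  \<comment> \<open>By the Leibniz rule the derivative of \<open>Y\<close> enters both sides as the
    same term and cancels. Parallelism is thus pointwise and can be tested on constant
    fields.\<close>
  have cd: "cov_deriv D X (\<lambda>q. J q (Y q)) p = J p (cov_deriv D X Y p) \<longleftrightarrow>
      frechet_derivative J (at p) (X p) (Y p) + D p (X p) (J p (Y p)) = J p (D p (X p) (Y p))"
    if "p \<in> M" "smooth_on M Y" for X Y p
  proof -
    have "((\<lambda>q. J q (Y q)) has_derivative (\<lambda>u. J p (frechet_derivative Y (at p) u)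
        + frechet_derivative J (at p) u (Y p))) (at p)"
      using bounded_bilinear.FDERIV[OF bounded_bilinear_blinfun_apply
          smooth_on_has_derivative[OF J that(1)] smooth_on_has_derivative[OF that(2,1)]] .
    from frechet_derivative_at[OF this, symmetric] show ?thesis
      by (simp add: cov_deriv_def blinfun.add_right algebra_simps)
  qed
  show ?thesis
  proof
    assume P: "parallel_endomorphism M D J"
    show "\<forall>p\<in>M. \<forall>u v. frechet_derivative J (at p) u v + D p u (J p v) = J p (D p u v)"
    proof (intro ballI allI)
      fix p u v assume "p \<in> M"
      then show "frechet_derivative J (at p) u v + D p u (J p v) = J p (D p u v)"
        using P cd[of p "\<lambda>_. v" "\<lambda>_. u"] smooth_on_const[OF M]
        unfolding parallel_endomorphism_def by blast
    qed
  qed (simp add: parallel_endomorphism_def cd)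
qed

lemma parallel_endomorphism_compose:
  assumes "open M" "smooth_on M J" "parallel_endomorphism M D I" "parallel_endomorphism M D J"
  shows "parallel_endomorphism M D (\<lambda>p. I p o\<^sub>L J p)"
  using assms smooth_on_blinfun_apply[of M J]
  by (simp add: parallel_endomorphism_def)

text \<open>Without torsion every bracket is a difference of covariant derivatives. Parallelism
  moves \<open>J\<close> out of them, and with square -1 the terms cancel in pairs.\<close>

lemma nijenhuis_eq_0_if_parallel:
  assumes M: "open M" and J: "smooth_on M J" and tf: "torsion_free M D"
    and par: "parallel_endomorphism M D J" and sq: "\<And>p. p \<in> M \<Longrightarrow> J p o\<^sub>L J p = - id_blinfun"
    and X: "smooth_on M X" and Y: "smooth_on M Y" and p: "p \<in> M"
  shows "nijenhuis J X Y p = 0"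
proof -
  note JX = smooth_on_blinfun_apply[OF M J X] and JY = smooth_on_blinfun_apply[OF M J Y]
  have br: "lie_bracket X Y p = cov_deriv D X Y p - cov_deriv D Y X p"
    if "smooth_on M X" "smooth_on M Y" for X Y
    using tf that p by (simp add: torsion_free_def)
  have pr: "cov_deriv D X (\<lambda>q. J q (Y q)) p = J p (cov_deriv D X Y p)"
    if "smooth_on M X" "smooth_on M Y" for X Y
    using par that p by (simp add: parallel_endomorphism_def)
  have "J p (J p v) = - v" for v
    using arg_cong[OF sq[OF p], of "\<lambda>A. A v"] by (simp add: blinfun.minus_left)
  then show ?thesis
    unfolding nijenhuis_def
    by (simp add: br pr X Y JX JY blinfun.diff_right)
qed

section \<open>Hyper-Hermitian structures from holomorphic functions\<close>

lemma rot_nth [simp]: "rot v $ 1 = - v $ 2" "rot v $ 2 = v $ 1"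
  by (simp_all add: rot_def)

lemma plane_eq_iff: "(u::real^2) = v \<longleftrightarrow> u $ 1 = v $ 1 \<and> u $ 2 = v $ 2"
  by (simp add: vec_eq_iff forall_2)

lemma inner_plane: "(u::real^2) \<bullet> v = u $ 1 * v $ 1 + u $ 2 * v $ 2"
  by (simp add: inner_vec_def sum_2)

lemma conformally_orthogonal_if_isometric:
  fixes J :: "'a::euclidean_space \<Rightarrow> 'a \<Rightarrow>\<^sub>L 'a"
  assumes "\<And>p u v. p \<in> M \<Longrightarrow> g p (J p u) (J p v) = g p u v"
  shows "conformally_orthogonal M (conformal_class M g) J"
  using assms by (auto simp: conformally_orthogonal_def conformal_class_def)

text \<open>The structure \<open>I\<close> of the hyper-Hermitian triple. For \<delta> = -1 it
  rotates both factors by the same right angle, which is how \<open>swap_structure\<close> uses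
  it.\<close>

definition block_rot :: "real \<Rightarrow> ((real^2) \<times> (real^2)) \<Rightarrow>\<^sub>L ((real^2) \<times> (real^2))" where
  "block_rot \<delta> = Blinfun (\<lambda>v. (rot (fst v), - \<delta> *\<^sub>R rot (snd v)))"

lemma block_rot_apply: "block_rot \<delta> v = (rot (fst v), - \<delta> *\<^sub>R rot (snd v))"
proof -
  have "linear (\<lambda>v. (rot (fst v), - \<delta> *\<^sub>R rot (snd v)))"
    by (auto intro!: linearI simp: plane_eq_iff algebra_simps)
  then show ?thesis
    unfolding block_rot_def by (simp add: bounded_linear_Blinfun_apply linear_conv_bounded_linear)
qed

text \<open>The reflection or identity diag(1, \<delta>), from the first factor to the second;
  \<open>swap_up\<close> is the way back.\<close>

definition swap_down :: "real \<Rightarrow> ((real^2) \<times> (real^2)) \<Rightarrow>\<^sub>L ((real^2) \<times> (real^2))" where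
  "swap_down \<delta> = Blinfun (\<lambda>v. (0, vector [fst v $ 1, \<delta> * fst v $ 2]))"

definition swap_up :: "real \<Rightarrow> ((real^2) \<times> (real^2)) \<Rightarrow>\<^sub>L ((real^2) \<times> (real^2))" where
  "swap_up \<delta> = Blinfun (\<lambda>v. (vector [snd v $ 1, \<delta> * snd v $ 2], 0))"

lemma swap_apply:
  "swap_down \<delta> v = (0, vector [fst v $ 1, \<delta> * fst v $ 2])"
  "swap_up \<delta> v = (vector [snd v $ 1, \<delta> * snd v $ 2], 0)"
proof -
  have "linear (\<lambda>v::(real^2) \<times> (real^2). (0::real^2, vector [fst v $ 1, \<delta> * fst v $ 2]::real^2))"
    "linear (\<lambda>v::(real^2) \<times> (real^2). (vector [snd v $ 1, \<delta> * snd v $ 2]::real^2, 0::real^2))"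
    by (auto intro!: linearI simp: plane_eq_iff algebra_simps)
  then show "swap_down \<delta> v = (0, vector [fst v $ 1, \<delta> * fst v $ 2])"
    "swap_up \<delta> v = (vector [snd v $ 1, \<delta> * snd v $ 2], 0)"
    unfolding swap_down_def swap_up_def
    by (simp_all add: bounded_linear_Blinfun_apply linear_conv_bounded_linear)
qed

text \<open>The lower block is \<open>exp (- f p)\<close> times R = rotation(\<alpha>) diag(1,
  \<delta>); for \<delta> = 1 or -1 the upper block is minus its inverse, so the square is -1. Fixed
  endomorphisms with scalar coefficients reduce smoothness and differentiation to scalar
  functions.\<close>

definition swap_structure :: "real \<Rightarrow> ('a \<Rightarrow> real) \<Rightarrow> ('a \<Rightarrow> real)
    \<Rightarrow> 'a \<Rightarrow> ((real^2) \<times> (real^2)) \<Rightarrow>\<^sub>L ((real^2) \<times> (real^2))" where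
  "swap_structure \<delta> f \<alpha> p =
     (exp (- f p) * cos (\<alpha> p)) *\<^sub>R swap_down \<delta>
     + (exp (- f p) * sin (\<alpha> p)) *\<^sub>R (block_rot (-1) o\<^sub>L swap_down \<delta>)
     + (- exp (f p) * cos (\<alpha> p)) *\<^sub>R swap_up \<delta>
     + (exp (f p) * sin (\<alpha> p)) *\<^sub>R (swap_up \<delta> o\<^sub>L block_rot (-1))"

lemma swap_structure_apply:
  "swap_structure \<delta> f \<alpha> p v =
    (vector [- exp (f p) * (cos (\<alpha> p) * snd v $ 1 + sin (\<alpha> p) * snd v $ 2),
             - \<delta> * exp (f p) * (cos (\<alpha> p) * snd v $ 2 - sin (\<alpha> p) * snd v $ 1)],
     vector [exp (- f p) * (cos (\<alpha> p) * fst v $ 1 - \<delta> * sin (\<alpha> p) * fst v $ 2),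
             exp (- f p) * (sin (\<alpha> p) * fst v $ 1 + \<delta> * cos (\<alpha> p) * fst v $ 2)])"
  by (simp add: swap_structure_def blinfun.add_left blinfun.diff_left blinfun.scaleR_left blinfun.minus_left
      swap_apply block_rot_apply prod_eq_iff plane_eq_iff algebra_simps)

lemma smooth_on_swap_structure:
  fixes f :: "'a::euclidean_space \<Rightarrow> real"
  assumes "open M" "smooth_on M f" "smooth_on M \<alpha>"
  shows "smooth_on M (swap_structure \<delta> f \<alpha>)"
proof -
  have "smooth_on M (\<lambda>p. - 1 * f p)" by (intro smooth_on_mult smooth_on_const assms)
  then have "smooth_on M (\<lambda>p. - f p)" by simp
  moreover have "smooth_on M (\<lambda>p. - 1 * exp (f p))"
    by (intro smooth_on_mult smooth_on_const smooth_on_exp assms)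
  then have "smooth_on M (\<lambda>p. - exp (f p))" by simp
  ultimately show ?thesis
    unfolding swap_structure_def[abs_def]
    by (intro smooth_on_add smooth_on_scaleR smooth_on_mult smooth_on_const smooth_on_exp
        smooth_on_cos smooth_on_sin assms)
qed

lemma frechet_derivative_swap_structure:
  assumes "(f has_derivative f') (at p)" "(\<alpha> has_derivative \<alpha>') (at p)"
  shows "frechet_derivative (swap_structure \<delta> f \<alpha>) (at p) u v =
    (vector [- exp (f p) * ((f' u * cos (\<alpha> p) - \<alpha>' u * sin (\<alpha> p)) * snd v $ 1
                 + (f' u * sin (\<alpha> p) + \<alpha>' u * cos (\<alpha> p)) * snd v $ 2),
             - \<delta> * exp (f p) * ((f' u * cos (\<alpha> p) - \<alpha>' u * sin (\<alpha> p)) * snd v $ 2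
                 - (f' u * sin (\<alpha> p) + \<alpha>' u * cos (\<alpha> p)) * snd v $ 1)],
     vector [exp (- f p) * ((- f' u * cos (\<alpha> p) - \<alpha>' u * sin (\<alpha> p)) * fst v $ 1
                 - \<delta> * (- f' u * sin (\<alpha> p) + \<alpha>' u * cos (\<alpha> p)) * fst v $ 2),
             exp (- f p) * ((- f' u * sin (\<alpha> p) + \<alpha>' u * cos (\<alpha> p)) * fst v $ 1
                 + \<delta> * (- f' u * cos (\<alpha> p) - \<alpha>' u * sin (\<alpha> p)) * fst v $ 2)])"
proof -
  have der: "(swap_structure \<delta> f \<alpha> has_derivative (\<lambda>u.
       (exp (- f p) * (- f' u * cos (\<alpha> p) - \<alpha>' u * sin (\<alpha> p))) *\<^sub>R swap_down \<delta>
     + (exp (- f p) * (- f' u * sin (\<alpha> p) + \<alpha>' u * cos (\<alpha> p))) *\<^sub>R (block_rot (-1) o\<^sub>L swap_down \<delta>)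
     + (- exp (f p) * (f' u * cos (\<alpha> p) - \<alpha>' u * sin (\<alpha> p))) *\<^sub>R swap_up \<delta>
     + (exp (f p) * (f' u * sin (\<alpha> p) + \<alpha>' u * cos (\<alpha> p))) *\<^sub>R (swap_up \<delta> o\<^sub>L block_rot (-1)))) (at p)"
    unfolding swap_structure_def[abs_def]
    by (rule derivative_eq_intros assms refl)+ (simp add: fun_eq_iff algebra_simps)
  show ?thesis
    unfolding frechet_derivative_at[OF der, symmetric]
    by (simp add: blinfun.add_left blinfun.diff_left blinfun.scaleR_left blinfun.minus_left
      swap_apply block_rot_apply prod_eq_iff plane_eq_iff algebra_simps)
qed

text \<open>\<open>I\<close> is parallel because it commutes with both blocks of the connection. It
  anticommutes with \<open>J\<close> because R turns \<open>rot\<close> into \<delta> times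
  \<open>rot\<close>, while \<open>I\<close> carries the factor -\<delta> on the second plane. The
  third structure is the product of the two.\<close>

lemma hyper_hermitian_if_primitive:
  assumes M: "open M" and f: "smooth_on M f"
    and D: "adapted_weyl M (conformal_class M (warped_metric f)) D"
    and \<delta>: "\<delta> * \<delta> = 1"
    and \<alpha>: "\<And>p. p \<in> M \<Longrightarrow>
      (\<alpha> has_derivative (\<lambda>u. \<delta> * omega1 f p (fst u) - omega2 f p (snd u))) (at p)"
  shows "hyper_hermitian M (conformal_class M (warped_metric f)) D"
proof -
  let ?c = "conformal_class M (warped_metric f)"
  define I where "I = (\<lambda>p::(real^2) \<times> (real^2). block_rot \<delta>)"
  define J where "J = swap_structure \<delta> f \<alpha>"
  have f': "(f has_derivative frechet_derivative f (at p)) (at p)" if "p \<in> M" for p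
    by (rule smooth_on_has_derivative[OF f that])
  have split: "frechet_derivative f (at p) u
      = frechet_derivative f (at p) (fst u, 0) + frechet_derivative f (at p) (0, snd u)"
    if "p \<in> M" for p u
    using linear_add[OF has_derivative_linear[OF f'[OF that]], of "(fst u, 0)" "(0, snd u)"] by simp
  have De: "D p u v = adapted_christoffel f p u v" if "p \<in> M" for p u v
    by (rule adapted_weyl_eq_christoffel[OF M f D that])
  have tf: "torsion_free M D" using D by (simp add: adapted_weyl_def weyl_structure_def)
  have ex: "exp (f p) * exp (- f p) = 1" for p by (simp flip: exp_add)
  have cs: "cos x * cos x + sin x * sin x = 1" for x :: real
    using sin_cos_squared_add[of x] by (simp add: power2_eq_square)
  have "smooth_on M (\<lambda>p. \<delta> * omega1 f p (fst u) - omega2 f p (snd u))" for u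
  proof -
    have "smooth_on M (\<lambda>p. (\<delta> * fst u $ 1) * frechet_derivative f (at p) (axis 2 1, 0)
       + (- \<delta> * fst u $ 2) * frechet_derivative f (at p) (axis 1 1, 0)
       + (- snd u $ 2) * frechet_derivative f (at p) (0, axis 1 1)
       + snd u $ 1 * frechet_derivative f (at p) (0, axis 2 1))"
      by (intro smooth_on_add smooth_on_mult smooth_on_const smooth_on_frechet_derivative M f)
    then show ?thesis by (simp add: omega1_def omega2_def algebra_simps)
  qed
  with \<alpha> have "smooth_on M \<alpha>"
    by (rule smooth_on_if_derivative_smooth_on[OF M])
  then have sJ: "smooth_on M J"
    unfolding J_def using M f by (intro smooth_on_swap_structure)
  have sI: "smooth_on M I" unfolding I_def by (rule smooth_on_const[OF M])
  have \<delta>1: "\<delta> = 1 \<or> \<delta> = - 1" using \<delta> by (simp add: square_eq_1_iff)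
  have I2: "I p (I p v) = - v" for p v
    using \<delta> by (simp add: I_def block_rot_apply prod_eq_iff plane_eq_iff)
  have J2: "J p (J p v) = - v" for p v
    unfolding J_def swap_structure_apply prod_eq_iff plane_eq_iff fst_conv snd_conv vector_2
      fst_uminus snd_uminus vector_uminus_component
    using ex[of p] cs[of "\<alpha> p"] \<delta> by (intro conjI; algebra)
  have IJ: "J p (I p v) = - I p (J p v)" for p v
    using \<delta>1
    by (auto simp: I_def J_def block_rot_apply swap_structure_apply prod_eq_iff plane_eq_iff algebra_simps)
  have oI: "conformally_orthogonal M ?c I"
  proof (rule conformally_orthogonal_if_isometric)
    show "warped_metric f p (I p u) (I p v) = warped_metric f p u v" for p u v
      unfolding I_def block_rot_apply warped_metric_def inner_plane using \<delta>
      by (simp add: algebra_simps) algebra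
  qed
  have oJ: "conformally_orthogonal M ?c J"
  proof (rule conformally_orthogonal_if_isometric)
    have e2: "exp (2 * f p) = exp (f p) * exp (f p)" for p by (simp flip: exp_add)
    show "warped_metric f p (J p u) (J p v) = warped_metric f p u v" for p u v
      unfolding J_def swap_structure_apply warped_metric_def inner_plane fst_conv snd_conv vector_2 e2
      using ex[of p] cs[of "\<alpha> p"] \<delta> by algebra
  qed
  have pI: "parallel_endomorphism M D I"
    unfolding parallel_endomorphism_iff[OF M sI]
  proof (intro ballI allI)
    fix p u v assume "p \<in> M"
    then show "frechet_derivative I (at p) u v + D p u (I p v) = I p (D p u v)"
      by (simp add: De I_def adapted_christoffel_def block_rot_apply prod_eq_iff plane_eq_iff
          algebra_simps)
  qed
  have pJ: "parallel_endomorphism M D J"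
    unfolding parallel_endomorphism_iff[OF M sJ]
  proof (intro ballI allI)
    fix p u v assume p: "p \<in> M"
    \<comment> \<open>Differentiating \<open>exp (- f p)\<close> cancels the trace parts -d_1 f and
      d_2 f of the connection; the differential of \<alpha> cancels the rotation parts. The upper
      block is analogous.\<close>
    show "frechet_derivative J (at p) u v + D p u (J p v) = J p (D p u v)"
      using \<delta>1
      by (auto simp: J_def De[OF p] frechet_derivative_swap_structure[OF f'[OF p] \<alpha>[OF p]]
          split[OF p, of u] adapted_christoffel_def swap_structure_apply prod_eq_iff plane_eq_iff
          algebra_simps simp del: split_paired_All)
  qed
  define K where "K = (\<lambda>p. I p o\<^sub>L J p)"
  have K2: "K p (K p v) = - v" for p v
    by (simp add: K_def IJ I2 J2 blinfun.minus_right)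
  have sK: "smooth_on M K"
    unfolding K_def by (rule smooth_on_blinfun_compose[OF M sI sJ])
  have pK: "parallel_endomorphism M D K"
    unfolding K_def by (rule parallel_endomorphism_compose[OF M sJ pI pJ])
  have oK: "conformally_orthogonal M ?c K"
    using oI oJ unfolding conformally_orthogonal_def K_def blinfun_apply_blinfun_compose by metis
  have cx: "complex_structure M A"
    if "smooth_on M A" "parallel_endomorphism M D A" "\<And>p v. A p (A p v) = - v" for A
  proof -
    have "A p o\<^sub>L A p = - id_blinfun" for p
      by (rule blinfun_eqI) (simp add: that(3) blinfun.minus_left)
    then show ?thesis
      unfolding complex_structure_def using nijenhuis_eq_0_if_parallel[OF M that(1) tf that(2)] that(1)
      by blast
  qed
  have "I p o\<^sub>L J p o\<^sub>L K p = - id_blinfun" for p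
    by (rule blinfun_eqI) (use K2[of p] in \<open>simp add: K_def blinfun.minus_left\<close>)
  then show ?thesis
    unfolding hyper_hermitian_def
    by (intro exI[of _ I] exI[of _ J] exI[of _ K])
       (auto intro: cx sI sJ sK pI pJ pK oI oJ oK I2 J2 K2)
qed

lemma linear_real2_pair:
  fixes l :: "(real^2) \<times> (real^2) \<Rightarrow> real"
  assumes "linear l"
  shows "l u = l (axis 1 1, 0) * fst u $ 1 + l (axis 2 1, 0) * fst u $ 2
    + l (0, axis 1 1) * snd u $ 1 + l (0, axis 2 1) * snd u $ 2"
proof -
  have "u = fst u $ 1 *\<^sub>R (axis 1 1, 0) + fst u $ 2 *\<^sub>R (axis 2 1, 0)
      + snd u $ 1 *\<^sub>R (0, axis 1 1) + snd u $ 2 *\<^sub>R (0, axis 2 1)"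
    by (simp add: prod_eq_iff plane_eq_iff axis_def)
  from arg_cong[OF this, of l] show ?thesis
    by (simp only: linear_add[OF assms] linear_scale[OF assms] real_scaleR_def mult.commute)
qed

lemma bounded_linear_complex_coord: "bounded_linear (complex_coord s)"
  by (auto intro!: linearI simp: linear_conv_bounded_linear[symmetric] complex_coord_def
      complex_eq_iff algebra_simps)

text \<open>The Cauchy-Riemann equations of \<open>F\<close> make its imaginary part, up to sign,
  the required angle, with \<delta> = s t. Only the product of the signs matters there, since
  conjugating both variables amounts to conjugating \<open>F\<close>.\<close>

lemma hyper_hermitian_if_real_part_of_holomorphic:
  assumes U: "open U1" "open U2" and f: "smooth_on (U1 \<times> U2) f"
    and D: "adapted_weyl (U1 \<times> U2) (conformal_class (U1 \<times> U2) (warped_metric f)) D"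
    and hol: "real_part_of_holomorphic U1 U2 f"
  shows "hyper_hermitian (U1 \<times> U2) (conformal_class (U1 \<times> U2) (warped_metric f)) D"
proof -
  have M: "open (U1 \<times> U2)" by (rule open_Times[OF U])
  obtain s t F where st: "s \<in> {1, -1}" "t \<in> {1, -1}"
    and F: "holomorphic2_on F ((complex_coord s ` U1) \<times> (complex_coord t ` U2))"
    and fF: "\<And>x y. x \<in> U1 \<Longrightarrow> y \<in> U2 \<Longrightarrow> f (x, y) = Re (F (complex_coord s x, complex_coord t y))"
    using hol unfolding real_part_of_holomorphic_def by blast
  define \<Phi> where "\<Phi> = (\<lambda>p. (complex_coord s (fst p), complex_coord t (snd p)))"
  define \<alpha> where "\<alpha> = (\<lambda>p. - t * Im (F (\<Phi> p)))"
  have \<Phi>: "bounded_linear \<Phi>"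
    unfolding \<Phi>_def
    by (intro bounded_linear_Pair bounded_linear_compose[OF bounded_linear_complex_coord]
        bounded_linear_fst bounded_linear_snd)
  have im: "\<Phi> ` (U1 \<times> U2) = (complex_coord s ` U1) \<times> (complex_coord t ` U2)"
    by (force simp: \<Phi>_def)
  have \<alpha>: "(\<alpha> has_derivative (\<lambda>u. (s * t) * omega1 f p (fst u) - omega2 f p (snd u))) (at p)"
    if p: "p \<in> U1 \<times> U2" for p
  proof -
    obtain a b where "(F has_derivative (\<lambda>h. a * fst h + b * snd h)) (at (\<Phi> p) within \<Phi> ` (U1 \<times> U2))"
      using bspec[OF F[folded im, unfolded holomorphic2_on_def] imageI[OF p]] by blast
    \<comment> \<open>\<open>F\<close> is differentiable only within the image of the domain; after
      pulling back to the open set \<open>U1 \<times> U2\<close> the restriction disappears.\<close>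
    from diff_chain_within[OF bounded_linear_imp_has_derivative[OF \<Phi>] this]
    have F': "((\<lambda>q. F (\<Phi> q)) has_derivative (\<lambda>u. a * fst (\<Phi> u) + b * snd (\<Phi> u))) (at p)"
      by (simp add: o_def at_within_open[OF p M])
    have "((\<lambda>q. Re (F (\<Phi> q))) has_derivative (\<lambda>u. Re (a * fst (\<Phi> u) + b * snd (\<Phi> u)))) (at p)"
      by (intro derivative_intros F')
    then have "(f has_derivative (\<lambda>u. Re (a * fst (\<Phi> u) + b * snd (\<Phi> u)))) (at p)"
      by (rule has_derivative_transform_within_open[OF _ M p]) (auto simp: fF \<Phi>_def)
    note f' = frechet_derivative_at[OF this, symmetric]
    have "(\<alpha> has_derivative (\<lambda>u. - t * Im (a * fst (\<Phi> u) + b * snd (\<Phi> u)))) (at p)"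
      unfolding \<alpha>_def by (intro derivative_intros F')
    moreover have "- t * Im (a * fst (\<Phi> u) + b * snd (\<Phi> u))
        = (s * t) * omega1 f p (fst u) - omega2 f p (snd u)" for u
      unfolding omega1_def omega2_def f' using st
      by (auto simp: \<Phi>_def complex_coord_def axis_def algebra_simps)
    ultimately show ?thesis by simp
  qed
  have "(s * t) * (s * t) = 1" using st by auto
  from hyper_hermitian_if_primitive[OF M f D this \<alpha>] show ?thesis .
qed

section \<open>Holomorphic functions from hyper-Hermitian structures\<close>

lemma has_derivative_continuous_logarithm:
  fixes g :: "'a::real_normed_vector \<Rightarrow> complex"
  assumes g: "continuous (at p) g" and ev: "\<forall>\<^sub>F q in nhds p. exp (g q) = u q"
    and u: "(u has_derivative u') (at p)"
  shows "(g has_derivative (\<lambda>h. u' h / u p)) (at p)"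
proof -
  have up: "exp (g p) = u p" using ev eventually_nhds_x_imp_x by fast
  then have [simp]: "u p \<noteq> 0" by (metis exp_not_eq_zero)
  have lim: "((\<lambda>q. Im (g q - g p)) \<longlongrightarrow> Im (g p - g p)) (nhds p)"
    using g by (intro tendsto_intros) (simp add: continuous_at tendsto_nhds_iff)
  then have "\<forall>\<^sub>F q in nhds p. \<bar>Im (g q - g p)\<bar> < pi"
    using tendstoD[OF lim pi_gt_zero] by (simp add: dist_real_def)
  \<comment> \<open>Near \<open>p\<close> the difference g q - g p lies in the strip where
    \<open>Ln\<close> inverts \<open>exp\<close>, so \<open>g\<close> coincides there with a
    differentiable branch of the logarithm.\<close>
  with ev have "\<forall>\<^sub>F q in nhds p. g p + Ln (u q / u p) = g q"
  proof eventually_elim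
    case (elim q)
    then have "u q / u p = exp (g q - g p)" using up by (simp add: exp_diff)
    then show ?case using elim(2) Ln_exp[of "g q - g p"] by simp
  qed
  moreover have "((\<lambda>q. g p + Ln (u q / u p)) has_derivative (\<lambda>h. u' h / u p)) (at p)"
  proof -
    have "((\<lambda>q. u q / u p) has_derivative (\<lambda>h. u' h / u p)) (at p)"
      using bounded_linear.has_derivative[OF bounded_linear_divide u] .
    moreover have "(Ln has_derivative (\<lambda>h. h)) (at (u p / u p))"
      using has_field_derivative_Ln[of 1] by (simp add: has_field_derivative_def lambda_one)
    ultimately show ?thesis
      using has_derivative_compose[of "\<lambda>q. u q / u p" _ p UNIV Ln]
      by (auto intro!: derivative_eq_intros)
  qed
  ultimately show ?thesis
    using has_derivative_transform_eventually[of "\<lambda>q. g p + Ln (u q / u p)" _ p UNIV g] up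
    by (auto simp: eventually_nhds_conv_at)
qed

lemma real_part_of_holomorphic_if_primitive:
  assumes \<delta>: "\<delta> \<in> {1, -1}"
    and f: "\<And>p. p \<in> V1 \<times> V2 \<Longrightarrow> (f has_derivative frechet_derivative f (at p)) (at p)"
    and \<alpha>: "\<And>p. p \<in> V1 \<times> V2 \<Longrightarrow>
      (\<alpha> has_derivative (\<lambda>u. \<delta> * omega1 f p (fst u) - omega2 f p (snd u))) (at p)"
  shows "real_part_of_holomorphic V1 V2 f"
proof -
  \<comment> \<open>Inverse of the coordinates with signs 1 and \<delta>; the holomorphic function
    is \<open>G\<close> composed with it.\<close>
  define \<Psi> :: "complex \<times> complex \<Rightarrow> (real^2) \<times> (real^2)"
    where "\<Psi> = (\<lambda>z. (vector [Re (fst z), Im (fst z)], vector [Re (snd z), \<delta> * Im (snd z)]))"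
  define G where "G = (\<lambda>q. of_real (f q) + \<i> * of_real (- \<delta> * \<alpha> q))"
  have \<Psi>: "bounded_linear \<Psi>"
    unfolding \<Psi>_def
    by (auto intro!: linearI simp: linear_conv_bounded_linear[symmetric] plane_eq_iff algebra_simps)
  have inv: "\<Psi> (complex_coord 1 x, complex_coord \<delta> y) = (x, y)" for x y
    using \<delta> by (auto simp: \<Psi>_def complex_coord_def plane_eq_iff)
  have "\<exists>a b. ((\<lambda>z. G (\<Psi> z)) has_derivative (\<lambda>h. a * fst h + b * snd h))
      (at z within complex_coord 1 ` V1 \<times> complex_coord \<delta> ` V2)"
    if z: "z \<in> complex_coord 1 ` V1 \<times> complex_coord \<delta> ` V2" for z
  proof -
    have p: "\<Psi> z \<in> V1 \<times> V2" using z inv by auto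
    define f' where "f' = frechet_derivative f (at (\<Psi> z))"
    have "(G has_derivative (\<lambda>u. of_real (f' u) + \<i> * of_real (- \<delta> *
        (\<delta> * omega1 f (\<Psi> z) (fst u) - omega2 f (\<Psi> z) (snd u))))) (at (\<Psi> z))"
      unfolding G_def f'_def by (intro derivative_intros f \<alpha> p)
    from has_derivative_compose[OF bounded_linear_imp_has_derivative[OF \<Psi>] this]
    have d: "((\<lambda>z. G (\<Psi> z)) has_derivative (\<lambda>h. of_real (f' (\<Psi> h)) + \<i> * of_real (- \<delta> *
        (\<delta> * omega1 f (\<Psi> z) (fst (\<Psi> h)) - omega2 f (\<Psi> z) (snd (\<Psi> h)))))) (at z)" .
    have lin: "linear f'" unfolding f'_def using f[OF p] by (rule has_derivative_linear)
    \<comment> \<open>The equation for \<alpha> makes this derivative complex linear; its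
      coefficients are twice the Wirtinger derivatives of \<open>f\<close> in the two
      variables.\<close>
    have "of_real (f' (\<Psi> h)) + \<i> * of_real (- \<delta> *
        (\<delta> * omega1 f (\<Psi> z) (fst (\<Psi> h)) - omega2 f (\<Psi> z) (snd (\<Psi> h))))
      = Complex (f' (axis 1 1, 0)) (- f' (axis 2 1, 0)) * fst h
        + Complex (f' (0, axis 1 1)) (- \<delta> * f' (0, axis 2 1)) * snd h" for h
      unfolding linear_real2_pair[OF lin, of "\<Psi> h"] omega1_def omega2_def f'_def[symmetric]
      using \<delta> by (auto simp: complex_eq_iff \<Psi>_def algebra_simps)
    from d[unfolded this] show ?thesis
      by (blast intro: has_derivative_at_withinI)
  qed
  moreover have "f (x, y) = Re (G (\<Psi> (complex_coord 1 x, complex_coord \<delta> y)))" for x y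
    by (simp add: inv G_def)
  ultimately show ?thesis
    unfolding real_part_of_holomorphic_def holomorphic2_on_def
    by (intro bexI[of _ 1] bexI[OF _ \<delta>] exI[of _ "\<lambda>z. G (\<Psi> z)"]) auto
qed

section \<open>The first two columns of a parallel complex structure\<close>

lemma orthogonal_complex_structure_columns:
  fixes A :: "(real^2) \<times> (real^2) \<Rightarrow> (real^2) \<times> (real^2)"
  assumes orth: "\<And>u v. warped_metric f p (A u) (A v) = warped_metric f p u v"
    and sq: "\<And>v. A (A v) = - v"
  defines "a \<equiv> A (axis 1 1, 0)" and "b \<equiv> A (axis 2 1, 0)"
  shows "fst a $ 1 = 0" "fst b $ 2 = 0" "fst b $ 1 = - fst a $ 2"
    "(fst a $ 2)\<^sup>2 + (exp (f p) * snd a $ 1)\<^sup>2 + (exp (f p) * snd a $ 2)\<^sup>2 = 1"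
    "(fst a $ 2)\<^sup>2 + (exp (f p) * snd b $ 1)\<^sup>2 + (exp (f p) * snd b $ 2)\<^sup>2 = 1"
    "(exp (f p) * snd a $ 1) * (exp (f p) * snd b $ 1)
      + (exp (f p) * snd a $ 2) * (exp (f p) * snd b $ 2) = 0"
proof -
  let ?g = "warped_metric f p"
  \<comment> \<open>An isometry with square -1 is skew. Its block on the first plane is therefore a
    multiple of \<open>rot\<close>; the remaining claims say that the two columns are
    orthonormal.\<close>
  have skew: "?g (A u) v = - ?g u (A v)" for u v
    using orth[of "A u" v] by (simp add: sq warped_metric_def)
  have e2: "exp (f p * 2) = exp (f p) * exp (f p)" by (simp flip: exp_add)
  have sym: "?g u v = ?g v u" for u v by (simp add: warped_metric_def inner_commute)
  show 1: "fst a $ 1 = 0"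
    using skew[of "(axis 1 1, 0)" "(axis 1 1, 0)"] sym[of "(axis 1 1, 0)" a]
    by (simp add: a_def warped_metric_def inner_axis)
  show 2: "fst b $ 2 = 0"
    using skew[of "(axis 2 1, 0)" "(axis 2 1, 0)"] sym[of "(axis 2 1, 0)" b]
    by (simp add: b_def warped_metric_def inner_axis)
  show 3: "fst b $ 1 = - fst a $ 2"
    using skew[of "(axis 2 1, 0)" "(axis 1 1, 0)"] sym[of "(axis 2 1, 0)" a]
    by (simp add: a_def b_def warped_metric_def inner_axis)
  show "(fst a $ 2)\<^sup>2 + (exp (f p) * snd a $ 1)\<^sup>2 + (exp (f p) * snd a $ 2)\<^sup>2 = 1"
    using orth[of "(axis 1 1, 0)" "(axis 1 1, 0)"] 1
    by (simp add: a_def warped_metric_def inner_plane e2 power2_eq_square algebra_simps axis_def)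
  show "(fst a $ 2)\<^sup>2 + (exp (f p) * snd b $ 1)\<^sup>2 + (exp (f p) * snd b $ 2)\<^sup>2 = 1"
    using orth[of "(axis 2 1, 0)" "(axis 2 1, 0)"] 2 3
    by (simp add: a_def b_def warped_metric_def inner_plane e2 power2_eq_square algebra_simps axis_def)
  show "(exp (f p) * snd a $ 1) * (exp (f p) * snd b $ 1)
      + (exp (f p) * snd a $ 2) * (exp (f p) * snd b $ 2) = 0"
    using orth[of "(axis 1 1, 0)" "(axis 2 1, 0)"] 1 2
    by (simp add: a_def b_def warped_metric_def inner_plane e2 power2_eq_square algebra_simps axis_def)
qed

text \<open>Parallelism gives d(A v) = A (D v) - D (A v). The first plane is parallel, so for its
  first basis vector the right side involves only the columns \<open>a\<close> and
  \<open>b\<close>.\<close>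

lemma parallel_columns_has_derivative:
  assumes M: "open M" and f: "smooth_on M f" and p: "p \<in> M"
    and D: "adapted_weyl M (conformal_class M (warped_metric f)) D"
    and A: "smooth_on M A" "parallel_endomorphism M D A"
  defines "a \<equiv> \<lambda>q. A q (axis 1 1, 0)" and "b \<equiv> \<lambda>q. A q (axis 2 1, 0)"
  shows "(a has_derivative (\<lambda>u. - frechet_derivative f (at p) (fst u, 0) *\<^sub>R a p
      + omega1 f p (fst u) *\<^sub>R b p - adapted_christoffel f p u (a p))) (at p)"
    and "continuous (at p) b"
proof -
  have d: "((\<lambda>q. A q v) has_derivative (\<lambda>u. A p (D p u v) - D p u (A p v))) (at p)" for v
  proof -
    have "frechet_derivative A (at p) u v = A p (D p u v) - D p u (A p v)" for u
      using A(2)[unfolded parallel_endomorphism_iff[OF M A(1)]] p by (metis add_diff_cancel_right')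
    moreover have "((\<lambda>q. A q v) has_derivative (\<lambda>u. frechet_derivative A (at p) u v)) (at p)"
      by (rule bounded_linear.has_derivative[OF blinfun.bounded_linear_left
            smooth_on_has_derivative[OF A(1) p]])
    ultimately show ?thesis by simp
  qed
  show "continuous (at p) b"
    unfolding b_def using d by (rule has_derivative_continuous)
  have "adapted_christoffel f p u (axis 1 1, 0) =
      - frechet_derivative f (at p) (fst u, 0) *\<^sub>R (axis 1 1, 0) + omega1 f p (fst u) *\<^sub>R (axis 2 1, 0)"
    for u
    by (simp add: adapted_christoffel_def prod_eq_iff plane_eq_iff axis_def)
  then show "(a has_derivative (\<lambda>u. - frechet_derivative f (at p) (fst u, 0) *\<^sub>R a p
      + omega1 f p (fst u) *\<^sub>R b p - adapted_christoffel f p u (a p))) (at p)"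
    using d[of "(axis 1 1, 0)"] unfolding a_def b_def
    by (simp only: adapted_weyl_eq_christoffel[OF M f D p] blinfun.add_right blinfun.scaleR_right)
qed

text \<open>The scaled lower block, with columns (x, y) and (z, w), is a constant times an
  orthogonal matrix of constant determinant \<delta>. The argument of x + i y, lifted continuously,
  is the angle \<alpha>.\<close>

lemma real_part_of_holomorphic_if_parallel_endomorphism:
  assumes M: "open M" and f: "smooth_on M f"
    and D: "adapted_weyl M (conformal_class M (warped_metric f)) D"
    and A: "smooth_on M A" "parallel_endomorphism M D A"
    and orth: "\<And>p u v. p \<in> M \<Longrightarrow> warped_metric f p (A p u) (A p v) = warped_metric f p u v"
    and sq: "\<And>p v. p \<in> M \<Longrightarrow> A p (A p v) = - v"
    and V: "open V1" "open V2" "V1 \<times> V2 \<subseteq> M" "simply_connected V1" "simply_connected V2"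
    and p0: "p0 \<in> V1 \<times> V2" and ne: "(fst (A p0 (axis 1 1, 0)) $ 2)\<^sup>2 \<noteq> 1"
  shows "real_part_of_holomorphic V1 V2 f"
proof -
  let ?V = "V1 \<times> V2"
  define a where "a = (\<lambda>q. A q (axis 1 1, 0))"
  define b where "b = (\<lambda>q. A q (axis 2 1, 0))"
  define l where "l = (\<lambda>q. fst (a q) $ 2)"
  define x where "x = (\<lambda>q. exp (f q) * snd (a q) $ 1)"
  define y where "y = (\<lambda>q. exp (f q) * snd (a q) $ 2)"
  define z where "z = (\<lambda>q. exp (f q) * snd (b q) $ 1)"
  define w where "w = (\<lambda>q. exp (f q) * snd (b q) $ 2)"
  have Vo: "open ?V" and Vs: "simply_connected ?V"
    using V by (auto intro: open_Times simply_connected_Times)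
  note Vc = simply_connected_imp_connected[OF Vs]
  have f': "(f has_derivative frechet_derivative f (at p)) (at p)" if "p \<in> ?V" for p
    using smooth_on_has_derivative[OF f] that V(3) by blast
  have split: "frechet_derivative f (at p) u
      = frechet_derivative f (at p) (fst u, 0) + frechet_derivative f (at p) (0, snd u)"
    if "p \<in> ?V" for p u
    using linear_add[OF has_derivative_linear[OF f'[OF that]], of "(fst u, 0)" "(0, snd u)"] by simp
  have a': "(a has_derivative (\<lambda>u. - frechet_derivative f (at p) (fst u, 0) *\<^sub>R a p
      + omega1 f p (fst u) *\<^sub>R b p - adapted_christoffel f p u (a p))) (at p)"
    and bc: "continuous (at p) b" if "p \<in> ?V" for p
    using parallel_columns_has_derivative[OF M f _ D A] that V(3) unfolding a_def b_def by blast+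
  have col: "fst (a p) $ 1 = 0" "fst (b p) $ 2 = 0" "fst (b p) $ 1 = - l p"
    "(l p)\<^sup>2 + (x p)\<^sup>2 + (y p)\<^sup>2 = 1" "(l p)\<^sup>2 + (z p)\<^sup>2 + (w p)\<^sup>2 = 1"
    "x p * z p + y p * w p = 0" if "p \<in> ?V" for p
    using orthogonal_complex_structure_columns[of f p "A p"] orth sq that V(3)
    unfolding a_def b_def l_def x_def y_def z_def w_def by blast+
  have nth: "bounded_linear (\<lambda>v::real^2. v $ i)" for i by (rule bounded_linear_vec_nth)
  \<comment> \<open>The block of \<open>A\<close> on the first plane is \<open>l\<close> times
    \<open>rot\<close>, which commutes with that block of the connection.\<close>
  have "(l has_derivative (\<lambda>h. 0)) (at p)" if p: "p \<in> ?V" for p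
  proof -
    have "(l has_derivative (\<lambda>u. fst (- frechet_derivative f (at p) (fst u, 0) *\<^sub>R a p
      + omega1 f p (fst u) *\<^sub>R b p - adapted_christoffel f p u (a p)) $ 2)) (at p)"
      unfolding l_def
      by (rule bounded_linear.has_derivative[OF nth has_derivative_fst[OF a'[OF p]]])
    then show ?thesis by (simp add: adapted_christoffel_def col[OF p])
  qed
  then have "l constant_on ?V"
    using has_derivative_zero_connected_constant_on[OF Vc Vo, of "{}" l]
    by (auto intro: has_derivative_at_withinI continuous_at_imp_continuous_on has_derivative_continuous)
  then obtain l0 where l0: "\<And>p. p \<in> ?V \<Longrightarrow> l p = l0" unfolding constant_on_def by blast
  \<comment> \<open>The squared length of both scaled columns. As \<open>l\<close> is constant, the
    assumption at \<open>p0\<close> makes it nonzero on the whole domain.\<close>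
  define r where "r = 1 - l0\<^sup>2"
  have r0: "r \<noteq> 0" using ne l0[OF p0] by (simp add: r_def l_def a_def)
  have r: "x p * x p + y p * y p = r" "z p * z p + w p * w p = r" if "p \<in> ?V" for p
    using col(4,5)[OF that] l0[OF that] by (simp_all add: r_def power2_eq_square)
  \<comment> \<open>The derivative of the factor \<open>exp (f q)\<close> absorbs all trace parts,
    leaving rotation terms only.\<close>
  have xy': "(x has_derivative (\<lambda>u. omega1 f p (fst u) * z p + omega2 f p (snd u) * y p)) (at p)"
    "(y has_derivative (\<lambda>u. omega1 f p (fst u) * w p - omega2 f p (snd u) * x p)) (at p)"
    if p: "p \<in> ?V" for p
  proof -
    have s: "((\<lambda>q. snd (a q) $ i) has_derivative (\<lambda>u. snd (- frechet_derivative f (at p) (fst u, 0) *\<^sub>R a p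
      + omega1 f p (fst u) *\<^sub>R b p - adapted_christoffel f p u (a p)) $ i)) (at p)" for i
      by (rule bounded_linear.has_derivative[OF nth has_derivative_snd[OF a'[OF p]]])
    note e = has_derivative_mult[OF DERIV_compose_FDERIV[OF DERIV_exp f'[OF p]] s]
    show "(x has_derivative (\<lambda>u. omega1 f p (fst u) * z p + omega2 f p (snd u) * y p)) (at p)"
      unfolding x_def
    proof (rule has_derivative_eq_rhs[OF e], rule ext, goal_cases)
      case (1 u)
      show ?case
        by (simp add: split[OF p, of u] y_def z_def adapted_christoffel_def algebra_simps)
    qed
    show "(y has_derivative (\<lambda>u. omega1 f p (fst u) * w p - omega2 f p (snd u) * x p)) (at p)"
      unfolding y_def
    proof (rule has_derivative_eq_rhs[OF e], rule ext, goal_cases)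
      case (1 u)
      show ?case
        by (simp add: split[OF p, of u] x_def w_def adapted_christoffel_def algebra_simps)
    qed
  qed
  define d where "d = (\<lambda>q. (x q * w q - y q * z q) / r)"
  note fc = has_derivative_continuous_on[OF has_derivative_at_withinI[OF f']]
    and xc = has_derivative_continuous_on[OF has_derivative_at_withinI[OF xy'(1)]]
    and yc = has_derivative_continuous_on[OF has_derivative_at_withinI[OF xy'(2)]]
  have bc': "continuous_on ?V b" using bc by (blast intro: continuous_at_imp_continuous_on)
  have dc: "continuous_on ?V d"
    unfolding d_def z_def w_def by (intro continuous_intros ballI fc bc' xc yc r0)
  have d1: "d p \<in> {1, -1}" if "p \<in> ?V" for p
  proof -
    \<comment> \<open>Lagrange's identity: for orthogonal columns the squared determinant is the
      product of the squared lengths.\<close>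
    have "(x p * w p - y p * z p) * (x p * w p - y p * z p) = (x p * x p + y p * y p)
        * (z p * z p + w p * w p) - (x p * z p + y p * w p) * (x p * z p + y p * w p)"
      by (simp add: algebra_simps)
    then have "(x p * w p - y p * z p) * (x p * w p - y p * z p) = r * r"
      by (simp add: r[OF that] col(6)[OF that])
    then have "d p * d p = 1" using r0 by (simp add: d_def field_simps)
    then show ?thesis by (simp add: square_eq_1_iff)
  qed
  \<comment> \<open>A continuous function with values 1 and -1 on a connected set.\<close>
  have "d constant_on ?V"
    by (rule continuous_finite_range_constant[OF Vc dc]) (use d1 in \<open>auto intro: finite_subset[of _ "{1, -1}"]\<close>)
  then obtain \<delta> where \<delta>: "\<And>p. p \<in> ?V \<Longrightarrow> d p = \<delta>" unfolding constant_on_def by blast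
  have \<delta>1: "\<delta> \<in> {1, -1}" using d1[OF p0] \<delta>[OF p0] by simp
  \<comment> \<open>Cramer's rule for the known inner product 0 and determinant \<delta> r: the
    second column is \<delta> times the first one turned by a right angle.\<close>
  have zw: "z p = - \<delta> * y p" "w p = \<delta> * x p" if "p \<in> ?V" for p
  proof -
    have "x p * w p - y p * z p = \<delta> * r" using \<delta>[OF that] r0 by (simp add: d_def field_simps)
    moreover have
      "(x p * x p + y p * y p) * z p = x p * (x p * z p + y p * w p) - y p * (x p * w p - y p * z p)"
      "(x p * x p + y p * y p) * w p = y p * (x p * z p + y p * w p) + x p * (x p * w p - y p * z p)"
      by (simp_all add: algebra_simps)
    ultimately have "r * z p = r * (- \<delta> * y p)" "r * w p = r * (x p * \<delta>)"
      by (simp_all add: r(1)[OF that] col(6)[OF that])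
    then show "z p = - \<delta> * y p" "w p = \<delta> * x p"
      unfolding mult_left_cancel[OF r0] by (simp_all only: mult.commute)
  qed
  define u where "u = (\<lambda>q. of_real (x q) + \<i> * of_real (y q))"
  let ?\<eta> = "\<lambda>p h. \<delta> * omega1 f p (fst h) - omega2 f p (snd h)"
  have u': "(u has_derivative (\<lambda>h. \<i> * of_real (?\<eta> p h) * u p)) (at p)" if p: "p \<in> ?V" for p
  proof -
    have "(u has_derivative (\<lambda>h. of_real (omega1 f p (fst h) * z p + omega2 f p (snd h) * y p)
        + \<i> * of_real (omega1 f p (fst h) * w p - omega2 f p (snd h) * x p))) (at p)"
      unfolding u_def by (intro derivative_intros xy' p)
    moreover have "of_real (omega1 f p (fst h) * z p + omega2 f p (snd h) * y p)
        + \<i> * of_real (omega1 f p (fst h) * w p - omega2 f p (snd h) * x p)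
      = \<i> * of_real (?\<eta> p h) * u p" for h
      by (simp add: complex_eq_iff u_def zw[OF p] algebra_simps)
    ultimately show ?thesis by simp
  qed
  have un: "u p \<noteq> 0" if "p \<in> ?V" for p
    using r(1)[OF that] r0 by (auto simp: u_def complex_eq_iff)
  have uc: "continuous_on ?V u" unfolding u_def by (intro continuous_intros xc yc)
  obtain g where g: "continuous_on ?V g" "\<And>p. p \<in> ?V \<Longrightarrow> u p = exp (g p)"
    \<comment> \<open>Simple connectedness enters here, to lift the nowhere vanishing
      \<open>u\<close> through the exponential.\<close>
    using continuous_logarithm_on_simply_connected[OF uc Vs open_imp_locally_path_connected[OF Vo] un]
    by blast
  have "((\<lambda>q. Im (g q)) has_derivative ?\<eta> p) (at p)" if p: "p \<in> ?V" for p
  proof -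
    have "continuous (at p) g" using g(1) Vo p continuous_on_eq_continuous_at by blast
    moreover have "\<forall>\<^sub>F q in nhds p. exp (g q) = u q"
      using g(2) Vo p unfolding eventually_nhds by metis
    ultimately have "(g has_derivative (\<lambda>h. \<i> * of_real (?\<eta> p h) * u p / u p)) (at p)"
      using u'[OF p] by (rule has_derivative_continuous_logarithm)
    from has_derivative_Im[OF this] show ?thesis using un[OF p] by simp
  qed
  with \<delta>1 f' show ?thesis by (rule real_part_of_holomorphic_if_primitive)
qed

section \<open>The converse direction and the equivalence\<close>

lemma real_part_of_holomorphic_if_hyper_hermitian:
  assumes M: "open M" and f: "smooth_on M f"
    and D: "adapted_weyl M (conformal_class M (warped_metric f)) D"
    and hh: "hyper_hermitian M (conformal_class M (warped_metric f)) D"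
    and V: "open V1" "open V2" "V1 \<times> V2 \<subseteq> M" "simply_connected V1" "simply_connected V2"
  shows "real_part_of_holomorphic V1 V2 f"
proof (cases "V1 \<times> V2 = {}")
  \<comment> \<open>The empty set is simply connected but offers no base point; the claim is vacuous
    there.\<close>
  case True
  then show ?thesis
    by (auto simp: real_part_of_holomorphic_def holomorphic2_on_def)
next
  case False
  then obtain p where p: "p \<in> V1 \<times> V2" by blast
  then have pM: "p \<in> M" using V(3) by blast
  obtain I J K where A: "\<And>A. A \<in> {I, J, K} \<Longrightarrow> complex_structure M A \<and>
      conformally_orthogonal M (conformal_class M (warped_metric f)) A \<and> parallel_endomorphism M D A"
    and IJK: "\<And>p. p \<in> M \<Longrightarrow> I p o\<^sub>L J p o\<^sub>L K p = - id_blinfun"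
    using hh unfolding hyper_hermitian_def by blast
  have orth: "warped_metric f q (A q u) (A q v) = warped_metric f q u v"
    if "A \<in> {I, J, K}" "q \<in> M" for A q u v
    using A[OF that(1)] that(2) warped_metric_in_class[OF M f]
    unfolding conformally_orthogonal_def by blast
  have sq: "A q (A q v) = - v" if "A \<in> {I, J, K}" "q \<in> M" for A q v
  proof -
    have "A q o\<^sub>L A q = - id_blinfun" using A[OF that(1)] that(2) by (simp add: complex_structure_def)
    from arg_cong[OF this, of "\<lambda>B. B v"] show ?thesis by (simp add: blinfun.minus_left)
  qed
  let ?e1 = "(axis 1 1, 0) :: (real^2) \<times> (real^2)" and ?e2 = "(axis 2 1, 0) :: (real^2) \<times> (real^2)"
  have "\<exists>A\<in>{I, J, K}. (fst (A p ?e1) $ 2)\<^sup>2 \<noteq> 1"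
  proof (rule ccontr)
    assume neg: "\<not> (\<exists>A\<in>{I, J, K}. (fst (A p ?e1) $ 2)\<^sup>2 \<noteq> 1)"
    \<comment> \<open>The entry of absolute value 1 exhausts the unit length of each column, so
      nothing remains in the second factor.\<close>
    have *: "A p ?e1 = (fst (A p ?e1) $ 2) *\<^sub>R ?e2" "A p ?e2 = - (fst (A p ?e1) $ 2) *\<^sub>R ?e1"
      if "A \<in> {I, J, K}" for A
    proof -
      have "(fst (A p ?e1) $ 2)\<^sup>2 = 1" using neg that by blast
      then show "A p ?e1 = (fst (A p ?e1) $ 2) *\<^sub>R ?e2" "A p ?e2 = - (fst (A p ?e1) $ 2) *\<^sub>R ?e1"
        using orthogonal_complex_structure_columns[of f p "A p", OF orth[OF that pM] sq[OF that pM]]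
        by (auto simp: prod_eq_iff plane_eq_iff axis_def sum_power2_eq_zero_iff)
    qed
    have "I p (J p (K p ?e1)) = - ?e1"
      using arg_cong[OF IJK[OF pM], of "\<lambda>B. B ?e1"] by (simp add: blinfun.minus_left)
    \<comment> \<open>Three maps that are each plus or minus \<open>rot\<close> on the first plane
      compose to a multiple of \<open>rot\<close>, never to minus the identity.\<close>
    moreover have "I p (J p (K p ?e1)) =
        (fst (K p ?e1) $ 2 * - (fst (J p ?e1) $ 2) * (fst (I p ?e1) $ 2)) *\<^sub>R ?e2"
      using *(1)[of K] *(2)[of J] *(1)[of I] blinfun.scaleR_right
      by (metis (no_types, lifting) insert_iff scaleR_scaleR)
    ultimately show False
      by (auto simp: prod_eq_iff plane_eq_iff axis_def)
  qed
  then obtain A' where A': "A' \<in> {I, J, K}" "(fst (A' p ?e1) $ 2)\<^sup>2 \<noteq> 1" by blast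
  have "smooth_on M A'" "parallel_endomorphism M D A'"
    using A[OF A'(1)] by (auto simp: complex_structure_def)
  from real_part_of_holomorphic_if_parallel_endomorphism[OF M f D this orth[OF A'(1)] sq[OF A'(1)] V p A'(2)]
  show ?thesis .
qed

text \<open>The parallel structure determines \<alpha> only modulo full turns, so around a hole the
  imaginary part may have periods. Hence the equivalence is stated for simply connected factors, and
  the converse in general on simply connected open subproducts.\<close>

theorem proposition6p4:
  fixes U1 U2 :: "(real^2) set"
    and f :: "(real^2) \<times> (real^2) \<Rightarrow> real"
    and D :: "((real^2) \<times> (real^2)) connection"
  defines "M \<equiv> U1 \<times> U2"
    and "c \<equiv> conformal_class (U1 \<times> U2) (warped_metric f)"
  assumes "open U1" and "open U2"
    and "smooth_on M f"
    and "adapted_weyl M c D"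
    and "\<not> closed_weyl M c D"
  shows "(simply_connected U1 \<and> simply_connected U2 \<longrightarrow>
            (hyper_hermitian M c D \<longleftrightarrow> real_part_of_holomorphic U1 U2 f)) \<and>
         (real_part_of_holomorphic U1 U2 f \<longrightarrow> hyper_hermitian M c D) \<and>
         (hyper_hermitian M c D \<longrightarrow>
            (\<forall>V1 V2. open V1 \<longrightarrow> open V2 \<longrightarrow> V1 \<subseteq> U1 \<longrightarrow> V2 \<subseteq> U2 \<longrightarrow>
               simply_connected V1 \<longrightarrow> simply_connected V2 \<longrightarrow>
               real_part_of_holomorphic V1 V2 f))"
proof -
  note as = assms(3-6)[unfolded M_def c_def]
  have 1: "hyper_hermitian M c D" if "real_part_of_holomorphic U1 U2 f"
    unfolding M_def c_def using as that by (rule hyper_hermitian_if_real_part_of_holomorphic)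
  have 2: "real_part_of_holomorphic V1 V2 f"
    if "hyper_hermitian M c D" "open V1" "open V2" "V1 \<subseteq> U1" "V2 \<subseteq> U2"
      "simply_connected V1" "simply_connected V2" for V1 V2
    using real_part_of_holomorphic_if_hyper_hermitian[OF open_Times[OF as(1,2)] as(3,4)
        that(1)[unfolded M_def c_def] that(2,3) Sigma_mono that(6,7)] that(4,5) by blast
  show ?thesis using 1 2 assms(3,4) by blast
qed

end
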